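(* Let $n$ and $k$ be positive integers. Let $\mathfrak{C}_n$ be a cyclic group of order $n$ acting on the gear graph $G_n$ (which has vertex set $\{0,1,\ldots,2n\}$), where a generator acts by $i\mapsto (i+2)\bmod 2n$ for $i\in\{0,\ldots,2n-1\}$ and fixes the vertex $2n$. Then $$\left(\mathcal{I}_k(G_n),\ \mathfrak{C}_n,\ \frac{[2n]}{[2n-k]}\begin{bmatrix} 2n-k\\ k\end{bmatrix}+\begin{bmatrix} n\\ k-1\end{bmatrix}\right)$$ exhibits the cyclic sieving phenomenon.
   Context: The gear graph $G_n$ has vertex set $\{0,1,\ldots,2n\}$; its edges are the edges $i\sim (i+1)\bmod 2n$ for $i\in\{0,\ldots,2n-1\}$ (the cycle $C_{2n}$) together with the edges joining $2n$ to $2i$ for every $i\in\{0,\ldots,n-1\}$. Graphs are simple. $\mathcal{I}_k(G)$ is the collection of independent sets of size $k$ of a graph $G$; a group acting on $G$ by automorphisms acts on $\mathcal{I}_k(G)$ by $\mathfrak{g}S=\{\mathfrak{g}v:v\in S\}$. $[m]=1+q+\cdots+q^{m-1}$, and $\begin{bmatrix} a\\ b\end{bmatrix}$ is the $q$-binomial coefficient, equal to $\frac{[a]!}{[b]!\,[a-b]!}$ for $0\le b\le a$ (with $[m]!=[1][2]\cdots[m]$) and $0$ otherwise. The term $\frac{[2n]}{[2n-k]}\begin{bmatrix} 2n-k\\ k\end{bmatrix}$ is read as $0$ when $k>n$; for $k\le n$ it is a polynomial in $q$. Cyclic sieving phenomenon (CSP): for a finite cyclic group $\mathfrak{C}$,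 a finite set $X$ and a polynomial $f(q)$, the triple $(X,\mathfrak{C},f(q))$ exhibits the CSP if $\mathfrak{C}$ acts on $X$ and for every $\mathfrak{g}\in\mathfrak{C}$ of order $d$ and every primitive $d$th root of unity $\omega\in\mathbb{C}$ we have $|X^{\mathfrak{g}}|=f(\omega)$, where $X^{\mathfrak{g}}=\{x\in X:\mathfrak{g}x=x\}$. *)

theory Defs
  imports
    "HOL-Algebra.Group_Action"
    "HOL-Algebra.Elementary_Groups"
    "HOL-Algebra.Multiplicative_Group"
    "HOL-Computational_Algebra.Polynomial"
    "Graph_Theory.Pair_Digraph"
begin

definition qint :: "nat \<Rightarrow> 'a::field poly" where
  "qint m = (\<Sum>i<m. monom 1 i)"

definition qfact :: "nat \<Rightarrow> 'a::field poly" where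
  "qfact m = (\<Prod>i=1..m. qint i)"

text \<open>
  Here \<open>div\<close> is division of polynomials over a field; it is exact by \<open>qfact_mult_dvd\<close> below.
\<close>

definition qbinomial :: "nat \<Rightarrow> nat \<Rightarrow> 'a::field poly" where
  "qbinomial a b = (if b \<le> a then qfact a div (qfact b * qfact (a - b)) else 0)"

text \<open>
  The polynomial \<open>[2n] / [2n - k] * qbinomial (2n - k) k\<close>; for \<open>k \<le> n\<close> the division is exact
  by \<open>qint_dvd_qint_mult_qbinomial\<close> below.
\<close>

definition qlucas_term :: "nat \<Rightarrow> nat \<Rightarrow> 'a::field poly" where
  "qlucas_term n k =
     (if k \<le> n then (qint (2 * n) * qbinomial (2 * n - k) k) div qint (2 * n - k) else 0)"

lemma qint_add: "qint (a + b) = qint a + monom 1 a * qint b"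
proof (induction b)
  case (Suc b)
  then show ?case by (simp add: qint_def mult_monom algebra_simps)
qed (simp add: qint_def)

lemma poly_qint_0: "m > 0 \<Longrightarrow> poly (qint m) 0 = 1"
  by (cases m) (simp_all add: qint_def poly_sum poly_monom sum.lessThan_Suc_shift del: sum.lessThan_Suc)

lemma qint_eq_0_iff: "qint m = 0 \<longleftrightarrow> m = 0"
proof (cases "m = 0")
  case False
  then have "poly (qint m :: 'a poly) 0 \<noteq> 0" by (simp add: poly_qint_0)
  with False show ?thesis by auto
qed (simp add: qint_def)

lemma qfact_Suc: "qfact (Suc m) = qfact m * qint (Suc m)"
  by (simp add: qfact_def)

lemma qfact_nonzero: "qfact m \<noteq> 0"
  by (simp add: qfact_def qint_eq_0_iff)

lemma qfact_mult_dvd: "qfact b * qfact c dvd (qfact (b + c) :: 'a::field poly)"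
proof (induction "b + c" arbitrary: b c)
  case 0
  then show ?case by (simp add: qfact_def)
next
  case (Suc m)
  show ?case
  proof (cases "b = 0 \<or> c = 0")
    case True
    then show ?thesis by (auto simp: qfact_def)
  next
    case False
    then obtain b' c' where bc: "b = Suc b'" "c = Suc c'" by (metis not0_implies_Suc)
    have m: "m = b' + c" "m = b + c'" using Suc.hyps(2) bc by auto
    have "qfact b' * qfact c dvd (qfact m :: 'a poly)" "qfact b * qfact c' dvd (qfact m :: 'a poly)"
      using Suc.hyps(1)[of b' c] Suc.hyps(1)[of b c'] m by auto
    then have "(qfact b' * qfact c) * qint b dvd (qfact m * qint b :: 'a poly)"
      and "(qfact b * qfact c') * qint c dvd (qfact m * qint c :: 'a poly)"
      by (auto intro: mult_dvd_mono)
    then have 1: "qfact b * qfact c dvd (qfact m * qint b :: 'a poly)"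
      and 2: "qfact b * qfact c dvd (qfact m * qint c :: 'a poly)"
      by (simp_all add: bc qfact_Suc mult_ac)
    have "qfact (b + c) = (qfact m * qint (b + c) :: 'a poly)"
      using Suc.hyps(2) qfact_Suc[of m] by simp
    also have "\<dots> = qfact m * qint b + monom 1 b * (qfact m * qint c)"
      by (simp add: qint_add algebra_simps)
    finally show ?thesis using 1 2 by (metis dvd_add dvd_mult)
  qed
qed

lemma qbinomial_mult_qfact:
  assumes "b \<le> a"
  shows "qbinomial a b * (qfact b * qfact (a - b)) = qfact a"
  unfolding qbinomial_def using assms qfact_mult_dvd[of b "a - b"]
  by (metis dvd_div_mult_self le_add_diff_inverse)

lemma qint_mult_qbinomial:
  assumes "Suc b \<le> Suc a"
  shows "qint (Suc b) * qbinomial (Suc a) (Suc b) = qint (Suc a) * (qbinomial a b :: 'a::field poly)"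
proof -
  let ?F = "qfact b * qfact (a - b) :: 'a poly"
  have "qint (Suc b) * qbinomial (Suc a) (Suc b) * ?F = qfact (Suc a)"
    using qbinomial_mult_qfact[of "Suc b" "Suc a"] assms by (simp add: qfact_Suc mult_ac)
  also have "\<dots> = qint (Suc a) * qbinomial a b * ?F"
    using qbinomial_mult_qfact[OF assms[unfolded Suc_le_mono]]
    by (metis mult.assoc mult.commute qfact_Suc)
  finally show ?thesis by (simp add: qfact_nonzero)
qed

lemma qint_dvd_qint_mult_qbinomial:
  assumes "k \<le> n"
  shows "qint (2 * n - k) dvd qint (2 * n) * (qbinomial (2 * n - k) k :: 'a::field poly)"
proof (cases "k = 0")
  case True
  then show ?thesis by simp
next
  case False
  define b where "b = k - 1"
  define a where "a = 2 * n - k - 1"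
  have ab: "k = Suc b" "2 * n - k = Suc a" "Suc b \<le> Suc a"
    using assms False by (simp_all add: a_def b_def)
  have "qint (2 * n) = qint (2 * n - k) + monom 1 (2 * n - k) * (qint k :: 'a poly)"
    using qint_add[of "2 * n - k" k] assms by simp
  then have "qint (2 * n) * qbinomial (2 * n - k) k =
      qint (2 * n - k) * qbinomial (2 * n - k) k +
      monom 1 (2 * n - k) * (qint k * (qbinomial (2 * n - k) k :: 'a poly))"
    by (simp add: algebra_simps)
  also have "qint k * qbinomial (2 * n - k) k = qint (2 * n - k) * (qbinomial a b :: 'a poly)"
    using qint_mult_qbinomial[OF ab(3)] ab by simp
  finally show ?thesis by (metis dvd_add dvd_mult dvd_triv_left)
qed

text \<open>
  A finite simple graph is a \<open>pair_graph\<close>: every edge is present as two opposite arcs.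
\<close>

definition gear_graph :: "nat \<Rightarrow> nat pair_pre_digraph" where
  "gear_graph n =
     (let E = {(i, (i + 1) mod (2 * n)) | i. i < 2 * n} \<union> {(2 * n, 2 * i) | i. i < n}
      in \<lparr>pverts = {0..2 * n}, parcs = E \<union> E\<inverse>\<rparr>)"

lemma pair_graph_gear_graph:
  assumes "n \<ge> 1"
  shows "pair_graph (gear_graph n)"
proof -
  have neq: "(i + 1) mod (2 * n) \<noteq> i" if "i < 2 * n" for i
    by (cases "i + 1 = 2 * n") (use that assms in \<open>simp_all, presburger?\<close>)
  have le: "(i + 1) mod (2 * n) \<le> 2 * n" for i
    using assms by (simp add: order.strict_implies_order)
  have "parcs (gear_graph n) \<subseteq> {0..2 * n} \<times> {0..2 * n}"
    using le by (auto simp: gear_graph_def Let_def)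
  then have fin: "finite (parcs (gear_graph n))"
    by (rule finite_subset) simp
  show ?thesis
  proof
    show "finite (parcs (gear_graph n))" by (fact fin)
    show "symmetric (gear_graph n)"
      by (auto simp: symmetric_def sym_def gear_graph_def Let_def)
  qed (use neq le in \<open>auto simp: gear_graph_def Let_def dest: sym\<close>)
qed

definition independent_sets :: "'a pair_pre_digraph \<Rightarrow> nat \<Rightarrow> 'a set set" where
  "independent_sets G k =
     {S. S \<subseteq> pverts G \<and> finite S \<and> card S = k \<and> (\<forall>u\<in>S. \<forall>v\<in>S. (u, v) \<notin> parcs G)}"

text \<open>
  Actions in the sense of \<open>group_action\<close> are by extensional bijections, hence the restriction.
\<close>

definition set_action :: "('g \<Rightarrow> 'a \<Rightarrow> 'a) \<Rightarrow> 'a set set \<Rightarrow> 'g \<Rightarrow> 'a set \<Rightarrow> 'a set" where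
  "set_action \<phi> X = (\<lambda>h. \<lambda>S\<in>X. \<phi> h ` S)"

definition primitive_root_of_unity :: "nat \<Rightarrow> complex \<Rightarrow> bool" where
  "primitive_root_of_unity d \<omega> \<longleftrightarrow> d > 0 \<and> \<omega> ^ d = 1 \<and> (\<forall>m. 0 < m \<and> m < d \<longrightarrow> \<omega> ^ m \<noteq> 1)"

definition cyclic_sieving ::
    "'x set \<Rightarrow> ('g, 'r) monoid_scheme \<Rightarrow> ('g \<Rightarrow> 'x \<Rightarrow> 'x) \<Rightarrow> complex poly \<Rightarrow> bool" where
  "cyclic_sieving X C \<phi> f \<longleftrightarrow>
     group C \<and> cyclic_group C \<and> finite (carrier C) \<and> finite X \<and> group_action C X \<phi> \<and>
     (\<forall>h\<in>carrier C. \<forall>\<omega>. primitive_root_of_unity (group.ord C h) \<omega> \<longrightarrow>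
        of_nat (card (invariants X \<phi> h)) = poly f \<omega>)"

end

theory Submission
  imports Defs "HOL-Number_Theory.Cong"
begin

text \<open>
  A rotation of order \<open>d\<close> in the cyclic group turns the rim of the gear graph by \<open>2 j\<close> places, where
  \<open>gcd j n = p\<close> and \<open>n = d * p\<close>.  The number of independent sets that it fixes and the value of the
  polynomial at a primitive \<open>d\<close>-th root of unity are computed separately and agree term by term.

  For the fixed points, independent sets are divided according to whether they contain the hub.
  Those that do not are independent sets of the cycle of length \<open>2n\<close>; those that do consist of the
  hub and \<open>k - 1\<close> arbitrary odd rim vertices.  A set of rim vertices is invariant under the rotation
  iff it is a union of residue classes modulo \<open>gcd (2 j) (2 n) = 2 p\<close>, that is, iff it is obtained
  from a set of residues modulo \<open>2p\<close> by repeating it \<open>d\<close> times (\<open>rotation_invariant_eq_unroll\<close>).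
  Repetition preserves and reflects independence in the cycle as well as oddness, and multiplies the
  size by \<open>d\<close>.  So the first kind is counted by the independent sets of size \<open>k / d\<close> in a cycle of
  length \<open>2p\<close> (\<open>card_cycle_independent\<close>), the second by the \<open>(k - 1) / d\<close>-subsets of \<open>p\<close> elements,
  and a kind contributes nothing if its size is not divisible by \<open>d\<close>.

  For the polynomial, the Lucas term is first rewritten as the sum of \<open>qbinomial (2n - k) k\<close> and
  \<open>q^(2n - k) * qbinomial (2n - k - 1) (k - 1)\<close>.  The q-Lucas theorem (\<open>q_Lucas\<close>) then evaluates all
  three Gaussian binomials at the root of unity.  If \<open>d\<close> divides \<open>k\<close>, the two summands become the two
  ordinary binomials that count independent sets of the shorter cycle by whether they contain a given
  vertex; otherwise they cancel (\<open>poly_qlucas_term\<close>).  The remaining binomial \<open>qbinomial n (k - 1)\<close> has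
  an upper index divisible by \<open>d\<close>, and hence takes the value \<open>p choose ((k - 1) div d)\<close> or \<open>0\<close>.
\<close>

section \<open>Gaussian binomials at roots of unity\<close>

lemma qbinomial_0 [simp]: "qbinomial a 0 = 1"
  by (simp add: qbinomial_def qfact_nonzero) (simp add: qfact_def qfact_nonzero)

lemma qbinomial_self [simp]: "qbinomial a a = 1"
  by (simp add: qbinomial_def qfact_nonzero) (simp add: qfact_def qfact_nonzero)

lemma qbinomial_eq_0: "a < b \<Longrightarrow> qbinomial a b = 0"
  by (simp add: qbinomial_def)

lemma qbinomial_Suc_Suc:
  "qbinomial (Suc a) (Suc b) = qbinomial a b + monom 1 (Suc b) * (qbinomial a (Suc b) :: 'a::field poly)"
proof (cases "b < a")
  case True
  define c where "c = a - Suc b"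
  have a: "a = Suc b + c" using True by (simp add: c_def)
  let ?F = "qfact (Suc b) * qfact (Suc c) :: 'a poly"
  have "qbinomial (Suc a) (Suc b) * ?F = qfact (Suc a)"
    using qbinomial_mult_qfact[of "Suc b" "Suc a"] by (simp add: a)
  moreover have "qbinomial a b * ?F = qfact a * qint (Suc b)"
    using qbinomial_mult_qfact[of b a, where 'a = 'a] by (simp add: a qfact_Suc[of b] mult_ac Suc_diff_le)
  moreover have "qbinomial a (Suc b) * ?F = qfact a * qint (Suc c)"
    using qbinomial_mult_qfact[of "Suc b" a, where 'a = 'a] by (simp add: a qfact_Suc[of c] mult_ac)
  moreover have "qfact (Suc a) = qfact a * (qint (Suc b) + monom 1 (Suc b) * qint (Suc c) :: 'a poly)"
    using qint_add[of "Suc b" "Suc c", where 'a = 'a] by (simp add: qfact_Suc a)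
  ultimately have "qbinomial (Suc a) (Suc b) * ?F
      = (qbinomial a b + monom 1 (Suc b) * qbinomial a (Suc b)) * ?F"
    by (simp add: algebra_simps)
  then show ?thesis by (simp add: qfact_nonzero)
next
  case False
  then consider "a = b" | "a < b" by linarith
  then show ?thesis by cases (simp_all add: qbinomial_eq_0)
qed

text \<open>
  The absorption identity without \<open>Suc\<close>, so that it applies to upper indices such as \<open>2 * n - k\<close>.
\<close>

lemma qbinomial_absorption:
  assumes "1 \<le> b" "b \<le> a"
  shows "qint b * qbinomial a b = qint a * (qbinomial (a - 1) (b - 1) :: 'a::field poly)"
proof -
  obtain a' b' where "a = Suc a'" "b = Suc b'"
    using assms by (metis One_nat_def Suc_le_D order_trans)
  then show ?thesis using qint_mult_qbinomial[of b' a'] assms(2) by simp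
qed

text \<open>
  Splitting \<open>[2n] = [2n - k] + q^(2n - k) [k]\<close> and absorbing \<open>[k]\<close> into the binomial makes the
  division by \<open>[2n - k]\<close> explicit.  The resulting sum of two binomials is what is evaluated at
  roots of unity, where \<open>[2n - k]\<close> itself may vanish.  For \<open>k > n\<close> both binomials vanish, in
  agreement with the convention for the left-hand side.
\<close>

lemma qlucas_term_eq_qbinomial:
  assumes "n \<ge> 1" "k \<ge> 1"
  shows "qlucas_term n k = qbinomial (2 * n - k) k
    + monom 1 (2 * n - k) * (qbinomial (2 * n - k - 1) (k - 1) :: 'a::field poly)"
proof (cases "k \<le> n")
  case True
  have k: "qint k * qbinomial (2 * n - k) k
      = qint (2 * n - k) * (qbinomial (2 * n - k - 1) (k - 1) :: 'a poly)"
    using assms True by (intro qbinomial_absorption) auto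
  have "qint (2 * n) = qint (2 * n - k) + monom 1 (2 * n - k) * (qint k :: 'a poly)"
    using qint_add[of "2 * n - k" k] True by simp
  then have "qint (2 * n) * qbinomial (2 * n - k) k
      = qint (2 * n - k) * qbinomial (2 * n - k) k
        + monom 1 (2 * n - k) * (qint k * (qbinomial (2 * n - k) k :: 'a poly))"
    by (simp add: algebra_simps)
  also have "\<dots> = qint (2 * n - k) * (qbinomial (2 * n - k) k
        + monom 1 (2 * n - k) * qbinomial (2 * n - k - 1) (k - 1))"
    by (simp only: k distrib_left mult.left_commute)
  moreover have "qint (2 * n - k) \<noteq> (0 :: 'a poly)"
    using True assms by (simp add: qint_eq_0_iff)
  ultimately show ?thesis using True by (simp add: qlucas_term_def)
next
  case False
  then show ?thesis using assms by (auto simp: qlucas_term_def qbinomial_eq_0)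
qed

lemma poly_qint_mult: "(x - 1) * poly (qint m) x = x ^ m - 1"
  by (simp add: qint_def poly_sum poly_monom power_diff_1_eq)

lemma primitive_root_of_unity_power_eq_1_iff:
  assumes "primitive_root_of_unity d \<omega>"
  shows "\<omega> ^ m = 1 \<longleftrightarrow> d dvd m"
proof
  have d: "d > 0" "\<omega> ^ d = 1" using assms by (auto simp: primitive_root_of_unity_def)
  have "\<omega> ^ m = \<omega> ^ (d * (m div d) + m mod d)" by simp
  also have "\<dots> = \<omega> ^ (m mod d)" unfolding power_add power_mult d(2) by simp
  finally have *: "\<omega> ^ m = \<omega> ^ (m mod d)" .
  show "d dvd m" if "\<omega> ^ m = 1"
  proof (rule ccontr)
    assume "\<not> d dvd m"
    then have "0 < m mod d" "m mod d < d" using d by (auto simp: dvd_eq_mod_eq_0)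
    then show False using assms that * by (auto simp: primitive_root_of_unity_def)
  qed
  show "\<omega> ^ m = 1" if "d dvd m" using that * by (simp add: dvd_eq_mod_eq_0)
qed

lemma poly_qint_eq_0_iff:
  assumes "primitive_root_of_unity d \<omega>" "d > 1"
  shows "poly (qint m) \<omega> = 0 \<longleftrightarrow> d dvd m"
proof -
  have "\<omega> \<noteq> 1"
    using primitive_root_of_unity_power_eq_1_iff[OF assms(1), of 1] assms(2) by auto
  then have "poly (qint m) \<omega> = 0 \<longleftrightarrow> \<omega> ^ m = 1"
    using poly_qint_mult[of \<omega> m] by (metis mult_eq_0_iff right_minus_eq)
  then show ?thesis using primitive_root_of_unity_power_eq_1_iff[OF assms(1)] by simp
qed

text \<open>
  In \<open>[b] * qbinomial d b = [d] * qbinomial (d - 1) (b - 1)\<close> the factor \<open>[d]\<close> vanishes at a primitive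
  \<open>d\<close>-th root of unity, while \<open>[b]\<close> does not because \<open>d\<close> does not divide \<open>b\<close>.
\<close>

lemma poly_qbinomial_order_eq_0:
  assumes \<omega>: "primitive_root_of_unity d \<omega>" and b: "0 < b" "b < d"
  shows "poly (qbinomial d b) \<omega> = 0"
proof -
  have "poly (qint b * qbinomial d b) \<omega> = poly (qint d * qbinomial (d - 1) (b - 1)) \<omega>"
    using qbinomial_absorption[of b d, where 'a = complex] b by simp
  moreover have "poly (qint d) \<omega> = 0" "poly (qint b) \<omega> \<noteq> 0"
    using poly_qint_eq_0_iff[OF \<omega>] b by (auto dest: dvd_imp_le)
  ultimately show ?thesis by simp
qed

text \<open>
  The right-hand side satisfies the same Pascal recurrence as the left-hand side.  Writing \<open>r\<close> and
  \<open>s\<close> for the last base-\<open>d\<close> digits of \<open>a\<close> and \<open>b - 1\<close>, this is Pascal's rule for the last digits if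
  neither digit carries.  If only \<open>s\<close> carries, the first summand has a lower digit exceeding the
  upper one and disappears.  If only \<open>r\<close> carries, the last digits contribute a middle binomial of
  row \<open>d\<close>, which vanishes at \<open>\<omega>\<close>.  If both carry, it is Pascal's rule for the quotients.
\<close>

theorem q_Lucas:
  assumes \<omega>: "primitive_root_of_unity d \<omega>"
  shows "poly (qbinomial a b) \<omega>
    = of_nat ((a div d) choose (b div d)) * poly (qbinomial (a mod d) (b mod d)) \<omega>"
proof (induction a arbitrary: b)
  case 0
  have "d > 0" using \<omega> by (simp add: primitive_root_of_unity_def)
  show ?case
  proof (cases "b mod d = 0")
    case True
    show ?thesis
    proof (cases "b = 0")
      case False
      then have "b div d > 0" using True \<open>d > 0\<close> by (auto simp: div_greater_zero_iff intro: dvd_imp_le)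
      then show ?thesis using False by (simp add: qbinomial_eq_0)
    qed simp
  next
    case False
    then have "b > 0" by (cases b) auto
    then show ?thesis using False by (simp add: qbinomial_eq_0)
  qed
next
  case (Suc a)
  have d: "d > 0" and \<omega>d: "\<omega> ^ d = 1" using \<omega> by (auto simp: primitive_root_of_unity_def)
  show ?case
  proof (cases b)
    case 0
    then show ?thesis by simp
  next
    case (Suc c)
    define A r where "A = a div d" and "r = a mod d"
    define B s where "B = c div d" and "s = c mod d"
    have r: "r < d" and s: "s < d" using d by (auto simp: r_def s_def)
    have eq: "poly (qbinomial (Suc a) (Suc c)) \<omega>
        = of_nat (A choose B) * poly (qbinomial r s) \<omega>
          + \<omega> ^ Suc c * (of_nat (A choose (Suc c div d)) * poly (qbinomial r (Suc c mod d)) \<omega>)"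
      unfolding qbinomial_Suc_Suc by (simp add: Suc.IH poly_monom A_def B_def r_def s_def)
    have pow: "\<omega> ^ Suc c = \<omega> ^ Suc s"
    proof -
      have "\<omega> ^ c = \<omega> ^ (d * B + s)" by (simp add: B_def s_def)
      also have "\<dots> = \<omega> ^ s" by (simp add: power_add power_mult \<omega>d)
      finally show ?thesis by simp
    qed
    have Sc: "Suc c div d = (if Suc s = d then Suc B else B)"
      "Suc c mod d = (if Suc s = d then 0 else Suc s)"
      by (auto simp: div_Suc mod_Suc B_def s_def)
    have Sa: "Suc a div d = (if Suc r = d then Suc A else A)"
      "Suc a mod d = (if Suc r = d then 0 else Suc r)"
      by (auto simp: div_Suc mod_Suc A_def r_def)
    consider (generic) "Suc r < d" "Suc s < d" | (column) "Suc r < d" "Suc s = d"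
      | (row) "Suc r = d" "Suc s < d" | (corner) "Suc r = d" "Suc s = d"
      using r s by linarith
    then show ?thesis
    proof cases
      case generic
      then show ?thesis using eq
        by (simp add: Suc Sa Sc pow qbinomial_Suc_Suc[of r s] poly_monom algebra_simps del: power_Suc)
    next
      case column
      then have "r < s" by simp
      then show ?thesis using eq column \<omega>d pow
        by (simp add: Suc Sa Sc qbinomial_eq_0 del: power_Suc)
    next
      case row
      have "poly (qbinomial r s) \<omega> + \<omega> ^ Suc s * poly (qbinomial r (Suc s)) \<omega> = 0"
        using poly_qbinomial_order_eq_0[OF \<omega>, of "Suc s"] row qbinomial_Suc_Suc[of r s, where 'a = complex]
        by (simp add: poly_monom del: power_Suc)
      then have "of_nat (A choose B) *
          (poly (qbinomial r s) \<omega> + \<omega> ^ Suc s * poly (qbinomial r (Suc s)) \<omega>) = 0" by simp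
      then have "poly (qbinomial (Suc a) (Suc c)) \<omega> = 0"
        using eq row by (simp add: Sc pow algebra_simps del: power_Suc)
      then show ?thesis using row by (simp add: Suc Sa Sc qbinomial_eq_0)
    next
      case corner
      then have "r = s" by simp
      then show ?thesis using eq corner \<omega>d pow
        by (simp add: Suc Sa Sc \<open>r = s\<close> del: power_Suc)
    qed
  qed
qed

corollary q_Lucas_digits:
  assumes "primitive_root_of_unity d \<omega>" "r < d" "s < d"
  shows "poly (qbinomial (d * a + r) (d * b + s)) \<omega> = of_nat (a choose b) * poly (qbinomial r s) \<omega>"
  unfolding q_Lucas[OF assms(1), of "d * a + r"] using assms(2,3) by simp

corollary poly_qbinomial_order_dvd:
  assumes \<omega>: "primitive_root_of_unity d \<omega>"
  shows "poly (qbinomial (d * a) b) \<omega> = (if d dvd b then of_nat (a choose (b div d)) else 0)"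
proof -
  have "d > 0" using \<omega> by (simp add: primitive_root_of_unity_def)
  then show ?thesis
    unfolding q_Lucas[OF \<omega>, of "d * a" b] by (auto simp: dvd_eq_mod_eq_0 qbinomial_eq_0)
qed

text \<open>
  If \<open>d\<close> divides \<open>k\<close>, the q-Lucas theorem reduces both binomials of \<open>qlucas_term_eq_qbinomial\<close> to
  ordinary ones: in the second, the last digits of \<open>2n - k - 1\<close> and \<open>k - 1\<close> are both \<open>d - 1\<close>.
  Otherwise let \<open>r\<close> be the last digit of \<open>k\<close>.  Both binomials then have the same quotient part, and
  their digit parts combine to \<open>[d] / [d - r]\<close> times \<open>qbinomial (d - r) r\<close>, which vanishes because
  \<open>[d]\<close> does.  For \<open>k > n\<close> both ordinary binomials are \<open>0\<close>; here \<open>m \<ge> 2\<close> is needed, since truncated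
  subtraction would give \<open>0 choose 0\<close> for \<open>m = 1\<close> and \<open>k = d\<close>.
\<close>

theorem poly_qlucas_term:
  assumes \<omega>: "primitive_root_of_unity d \<omega>" and n: "2 * n = d * m" "m \<ge> 2" and k: "k \<ge> 1"
  shows "poly (qlucas_term n k) \<omega> = (if d dvd k
    then of_nat ((m - k div d choose (k div d)) + (m - k div d - 1 choose (k div d - 1))) else 0)"
proof (cases "k \<le> n")
  case False
  have d: "d > 0" using \<omega> by (simp add: primitive_root_of_unity_def)
  have "m - k div d < k div d" "m - k div d - 1 < k div d - 1" if "d dvd k"
  proof -
    obtain l where l: "k = d * l" using \<open>d dvd k\<close> by auto
    have "d * m < 2 * k" using False n by linarith
    then have "d * m < d * (2 * l)" by (simp only: l mult.left_commute)
    then have "m < 2 * l" using d by (simp only: mult_less_cancel1)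
    then show "m - k div d < k div d" "m - k div d - 1 < k div d - 1"
      using n(2) d by (auto simp: l)
  qed
  then show ?thesis using False by (cases "d dvd k") (simp_all add: qlucas_term_def binomial_eq_0)
next
  case True
  have d: "d > 0" and \<omega>d: "\<omega> ^ d = 1" using \<omega> by (auto simp: primitive_root_of_unity_def)
  define a where "a = 2 * n - k"
  have val: "poly (qlucas_term n k) \<omega> = poly (qbinomial a k) \<omega> + \<omega> ^ a * poly (qbinomial (a - 1) (k - 1)) \<omega>"
    using qlucas_term_eq_qbinomial[of n k, where 'a = complex] True k by (simp add: a_def poly_monom)
  show ?thesis
  proof (cases "d dvd k")
    case dk: True
    then obtain l where l: "k = d * l" by auto
    have "l \<ge> 1" using l k by (cases l) auto
    have "2 * k \<le> d * m" using True n by linarith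
    then have "d * (2 * l) \<le> d * m" by (simp only: l mult.left_commute)
    then have lm: "2 * l \<le> m" using d by (simp only: mult_le_cancel1)
    have a: "a = d * (m - l)" by (simp only: a_def n(1) l right_diff_distrib')
    have pred: "d * x - 1 = d * (x - 1) + (d - 1)" if "x \<ge> 1" for x
      using that d by (cases x) auto
    have a1: "a - 1 = d * (m - l - 1) + (d - 1)" and k1: "k - 1 = d * (l - 1) + (d - 1)"
      using pred[of "m - l"] pred[of l] lm \<open>l \<ge> 1\<close> by (simp_all add: a l)
    have "poly (qbinomial (a - 1) (k - 1)) \<omega> = of_nat (m - l - 1 choose (l - 1))"
      unfolding a1 k1 using d by (subst q_Lucas_digits[OF \<omega>]) auto
    moreover have "poly (qbinomial a k) \<omega> = of_nat (m - l choose l)"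
      using d by (simp add: a l poly_qbinomial_order_dvd[OF \<omega>])
    moreover have "\<omega> ^ a = 1" by (simp add: a power_mult \<omega>d)
    ultimately show ?thesis using dk d val by (simp add: l)
  next
    case ndk: False
    then have "d > 1" using d by (cases "d = 1") auto
    define r where "r = k mod d"
    have r: "0 < r" "r < d" using ndk d by (auto simp: r_def dvd_eq_mod_eq_0)
    have kr: "k = d * (k div d) + r" by (simp add: r_def)
    have "d * (k div d) + r < d * m" using True n k kr by linarith
    then have "d * (k div d) < d * m" by linarith
    then have less: "k div d < m" using d by (simp only: mult_less_cancel1)
    define A where "A = m - k div d - 1"
    have "m = k div d + A + 1" using less by (simp add: A_def)
    then have "d * m = d * (k div d + A + 1)" by (rule arg_cong)
    also have "\<dots> = d * (k div d) + d * A + d" by (simp only: distrib_left mult_1_right)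
    finally have "d * m = d * (k div d) + d * A + d" .
    then have a: "a = d * A + (d - r)"
      using kr r n(1) unfolding a_def by linarith
    have a1: "a - 1 = d * A + (d - r - 1)" and k1: "k - 1 = d * (k div d) + (r - 1)"
      using a kr r by linarith+
    have q1: "poly (qbinomial a k) \<omega> = of_nat (A choose (k div d)) * poly (qbinomial (d - r) r) \<omega>"
      using q_Lucas_digits[OF \<omega>, of "d - r" r A "k div d"] r a kr by simp
    have q2: "poly (qbinomial (a - 1) (k - 1)) \<omega>
        = of_nat (A choose (k div d)) * poly (qbinomial (d - r - 1) (r - 1)) \<omega>"
      using q_Lucas_digits[OF \<omega>, of "d - r - 1" "r - 1" A "k div d"] r
      by (simp only: a1[symmetric] k1[symmetric])
    have wa: "\<omega> ^ a = \<omega> ^ (d - r)" by (simp add: a power_add power_mult \<omega>d)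
    have "poly (qbinomial (d - r) r) \<omega> + \<omega> ^ (d - r) * poly (qbinomial (d - r - 1) (r - 1)) \<omega> = 0"
    proof (cases "r \<le> d - r")
      case True
      \<comment> \<open>After multiplication by \<open>[d - r]\<close>, the digit parts have the common factor \<open>[d - r] + q^(d - r) [r] = [d]\<close>.\<close>
      have combine: "D * (x + w * y) = 0" if "D + w * R = 0" "R * x = D * y" for D R w x y :: complex
      proof -
        have "D * (x + w * y) = D * x + w * (D * y)" by (simp add: algebra_simps)
        also have "\<dots> = (D + w * R) * x" by (simp add: algebra_simps flip: that(2))
        finally show ?thesis by (simp add: that(1))
      qed
      have "qint r * qbinomial (d - r) r = qint (d - r) * (qbinomial (d - r - 1) (r - 1) :: complex poly)"
        using r True by (intro qbinomial_absorption) auto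
      then have e: "poly (qint r) \<omega> * poly (qbinomial (d - r) r) \<omega>
          = poly (qint (d - r)) \<omega> * poly (qbinomial (d - r - 1) (r - 1)) \<omega>"
        by (metis poly_mult)
      have "qint d = qint (d - r) + monom 1 (d - r) * (qint r :: complex poly)"
        using qint_add[of "d - r" r] r by simp
      then have "poly (qint (d - r)) \<omega> + \<omega> ^ (d - r) * poly (qint r) \<omega> = 0"
        using poly_qint_eq_0_iff[OF \<omega> \<open>d > 1\<close>, of d] by (simp add: poly_monom)
      then have "poly (qint (d - r)) \<omega> *
          (poly (qbinomial (d - r) r) \<omega> + \<omega> ^ (d - r) * poly (qbinomial (d - r - 1) (r - 1)) \<omega>) = 0"
        using e combine by blast
      moreover have "poly (qint (d - r)) \<omega> \<noteq> 0"
        using poly_qint_eq_0_iff[OF \<omega> \<open>d > 1\<close>, of "d - r"] r by (auto dest: dvd_imp_le)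
      ultimately show ?thesis by simp
    next
      case False
      then show ?thesis using r by (simp add: qbinomial_eq_0)
    qed
    then have "of_nat (A choose (k div d)) * (poly (qbinomial (d - r) r) \<omega>
        + \<omega> ^ (d - r) * poly (qbinomial (d - r - 1) (r - 1)) \<omega>) = 0" by simp
    then have "poly (qlucas_term n k) \<omega> = 0"
      unfolding val q1 q2 wa by (simp only: distrib_left mult.left_commute)
    then show ?thesis using ndk by simp
  qed
qed

section \<open>Independent sets of paths and cycles\<close>

definition path_independent_sets :: "nat \<Rightarrow> nat \<Rightarrow> nat set set" where
  "path_independent_sets m k = {S. S \<subseteq> {..<m} \<and> card S = k \<and> (\<forall>i\<in>S. Suc i \<notin> S)}"

lemma finite_path_independent_sets: "finite (path_independent_sets m k)"
  by (rule finite_subset[of _ "Pow {..<m}"]) (auto simp: path_independent_sets_def)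

text \<open>
  An independent set containing the last vertex avoids its predecessor.
\<close>

lemma path_independent_sets_Suc_Suc:
  "path_independent_sets (Suc (Suc m)) (Suc k)
     = path_independent_sets (Suc m) (Suc k) \<union> insert (Suc m) ` path_independent_sets m k"
proof (intro equalityI subsetI)
  fix S assume S: "S \<in> path_independent_sets (Suc (Suc m)) (Suc k)"
  then have fin: "finite S" by (auto simp: path_independent_sets_def intro: finite_subset)
  show "S \<in> path_independent_sets (Suc m) (Suc k) \<union> insert (Suc m) ` path_independent_sets m k"
  proof (cases "Suc m \<in> S")
    case True
    have "m \<notin> S" using S True by (auto simp: path_independent_sets_def)
    then have "S - {Suc m} \<in> path_independent_sets m k"
      using S True fin by (auto simp: path_independent_sets_def less_Suc_eq)
    moreover have "S = insert (Suc m) (S - {Suc m})" using True by auto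
    ultimately show ?thesis by blast
  next
    case False
    then show ?thesis using S by (auto simp: path_independent_sets_def less_Suc_eq)
  qed
next
  fix S assume "S \<in> path_independent_sets (Suc m) (Suc k) \<union> insert (Suc m) ` path_independent_sets m k"
  then consider "S \<in> path_independent_sets (Suc m) (Suc k)"
    | T where "S = insert (Suc m) T" "T \<in> path_independent_sets m k" by auto
  then show "S \<in> path_independent_sets (Suc (Suc m)) (Suc k)"
  proof cases
    case 1
    then show ?thesis by (auto simp: path_independent_sets_def less_Suc_eq)
  next
    case 2
    then have T: "T \<subseteq> {..<m}" "card T = k" "\<And>i. i \<in> T \<Longrightarrow> Suc i \<notin> T"
      by (auto simp: path_independent_sets_def)
    then have "finite T" "Suc m \<notin> T" "m \<notin> T" "Suc (Suc m) \<notin> T" by (auto intro: finite_subset)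
    then show ?thesis using T 2(1) by (auto simp: path_independent_sets_def)
  qed
qed

lemma card_path_independent_sets: "card (path_independent_sets m k) = (m + 1 - k choose k)"
proof (induction m arbitrary: k rule: induct_nat_012)
  case 0
  have "path_independent_sets 0 k = (if k = 0 then {{}} else {})"
    by (auto simp: path_independent_sets_def)
  then show ?case by simp
next
  case 1
  have "path_independent_sets (Suc 0) k = (if k = 0 then {{}} else if k = 1 then {{0}} else {})"
    by (auto simp: path_independent_sets_def lessThan_Suc subset_singleton_iff)
  then show ?case by simp
next
  case (ge2 m)
  show ?case
  proof (cases k)
    case 0
    have "path_independent_sets (Suc (Suc m)) 0 = {{}}"
      by (auto simp: path_independent_sets_def dest: finite_subset[OF _ finite_lessThan])
    then show ?thesis using 0 by simp
  next
    case (Suc l)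
    have notin: "Suc m \<notin> S" if "S \<in> path_independent_sets (Suc m) j \<or> S \<in> path_independent_sets m j" for S j
      using that by (auto simp: path_independent_sets_def)
    have "inj_on (insert (Suc m)) (path_independent_sets m l)"
      using notin by (intro inj_onI) (metis insert_ident)
    then have "card (path_independent_sets (Suc (Suc m)) k)
        = card (path_independent_sets (Suc m) k) + card (path_independent_sets m l)"
      unfolding Suc path_independent_sets_Suc_Suc
      by (subst card_Un_disjoint) (use notin in \<open>auto simp: finite_path_independent_sets card_image\<close>)
    also have "\<dots> = (Suc m - l choose Suc l) + (Suc m - l choose l)"
      by (simp add: ge2.IH Suc)
    also have "\<dots> = (Suc (Suc m) - l choose Suc l)"
      by (cases "l \<le> Suc m") (simp_all add: Suc_diff_le)
    finally show ?thesis by (simp add: Suc)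
  qed
qed

text \<open>
  For \<open>m = 1\<close> the only vertex is its own successor, so that a nonempty set is never independent.  This
  convention makes independence compatible with every wrapping of a cycle around a shorter one.
\<close>

definition cycle_independent :: "nat \<Rightarrow> nat set \<Rightarrow> bool" where
  "cycle_independent m S \<longleftrightarrow> (\<forall>i\<in>S. (i + 1) mod m \<notin> S)"

text \<open>
  Removing the vertex \<open>m - 1\<close> leaves a path on \<open>m - 1\<close> vertices.  An independent set that contains
  \<open>m - 1\<close> avoids \<open>0\<close> and \<open>m - 2\<close>, so that its other elements lie on the path \<open>1, ..., m - 3\<close>, which is
  the image under \<open>Suc\<close> of the path on \<open>m - 3\<close> vertices.  For \<open>m = 2\<close> truncated subtraction turns
  the latter into the empty path, which is again correct.
\<close>

lemma card_cycle_independent: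
  assumes m: "m \<ge> 2" and k: "k \<ge> 1"
  shows "card {S. S \<subseteq> {..<m} \<and> card S = k \<and> cycle_independent m S}
    = (m - k choose k) + (m - k - 1 choose (k - 1))"
proof -
  let ?A = "path_independent_sets (m - 1) k"
  let ?f = "\<lambda>T. insert (m - 1) (Suc ` T)"
  let ?B = "?f ` path_independent_sets (m - 3) (k - 1)"
  have "{S. S \<subseteq> {..<m} \<and> card S = k \<and> cycle_independent m S} = ?A \<union> ?B"
  proof (intro equalityI subsetI)
    fix S assume "S \<in> {S. S \<subseteq> {..<m} \<and> card S = k \<and> cycle_independent m S}"
    then have S: "S \<subseteq> {..<m}" "card S = k" "\<And>i. i \<in> S \<Longrightarrow> (i + 1) mod m \<notin> S"
      by (auto simp: cycle_independent_def)
    have fin: "finite S" using S(1) finite_subset by blast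
    have step: "Suc i \<notin> S" if "i \<in> S" for i
    proof
      assume "Suc i \<in> S"
      then have "(i + 1) mod m = Suc i" using S(1) by auto
      then show False using S(3)[OF that] \<open>Suc i \<in> S\<close> by simp
    qed
    show "S \<in> ?A \<union> ?B"
    proof (cases "m - 1 \<in> S")
      case False
      have "S \<subseteq> {..<m - 1}"
      proof
        fix i assume "i \<in> S"
        then have "i < m" "i \<noteq> m - 1" using S(1) False by auto
        then show "i \<in> {..<m - 1}" by simp
      qed
      then show ?thesis using S step by (auto simp: path_independent_sets_def)
    next
      case True
      have 0: "0 \<notin> S" using S(3)[OF True] m by simp
      have m2: "m - 2 \<notin> S" using step[of "m - 2"] True m by (metis Suc_diff_Suc Suc_1 Suc_le_eq diff_Suc_1 diff_diff_left plus_1_eq_Suc)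
      define T where "T = {i. Suc i \<in> S - {m - 1}}"
      have "x \<in> Suc ` T" if "x \<in> S" "x \<noteq> m - 1" for x
        using that 0 by (cases x) (auto simp: T_def)
      then have ST: "S = ?f T" using True by (auto simp: T_def)
      have "i < m - 3" if "i \<in> T" for i
      proof -
        have "Suc i \<in> S" "Suc i \<noteq> m - 1" using that by (auto simp: T_def)
        moreover from this have "Suc i < m" "Suc i \<noteq> m - 2" using S(1) m2 by auto
        ultimately show ?thesis by linarith
      qed
      moreover have "card T = k - 1"
      proof -
        have "Suc ` T = S - {m - 1}" using ST True by (auto simp: T_def)
        then have "card (Suc ` T) = k - 1" using S(2) fin True by simp
        then show ?thesis by (simp add: card_image)
      qed
      moreover have "Suc i \<notin> T" if "i \<in> T" for i using that step by (auto simp: T_def)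
      ultimately have "T \<in> path_independent_sets (m - 3) (k - 1)"
        by (auto simp: path_independent_sets_def)
      then show ?thesis using ST by blast
    qed
  next
    fix S assume "S \<in> ?A \<union> ?B"
    then consider "S \<in> ?A" | T where "S = ?f T" "T \<in> path_independent_sets (m - 3) (k - 1)" by blast
    then show "S \<in> {S. S \<subseteq> {..<m} \<and> card S = k \<and> cycle_independent m S}"
    proof cases
      case 1
      then have S: "S \<subseteq> {..<m - 1}" "card S = k" "\<And>i. i \<in> S \<Longrightarrow> Suc i \<notin> S"
        by (auto simp: path_independent_sets_def)
      have "(i + 1) mod m \<notin> S" if "i \<in> S" for i
      proof -
        have "i + 1 < m" using that S(1) by auto
        then show ?thesis using S(3)[OF that] by simp
      qed
      moreover have "S \<subseteq> {..<m}" using S(1) by auto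
      ultimately show ?thesis using S by (auto simp: cycle_independent_def)
    next
      case 2
      then have T: "T \<subseteq> {..<m - 3}" "card T = k - 1" "\<And>i. i \<in> T \<Longrightarrow> Suc i \<notin> T"
        by (auto simp: path_independent_sets_def)
      have lt: "i + 3 < m" if "i \<in> T" for i using that T(1) by auto
      have "finite T" using T(1) finite_subset by blast
      moreover have "m - 1 \<notin> Suc ` T" using lt by fastforce
      ultimately have "card S = k" using T(2) k by (simp add: 2 card_image)
      moreover have "S \<subseteq> {..<m}" using 2 m lt by fastforce
      moreover have "(i + 1) mod m \<notin> S" if i: "i \<in> S" for i
      proof (cases "i = m - 1")
        case True
        then show ?thesis using m by (auto simp: 2)
      next
        case False
        then obtain j where j: "i = Suc j" "j \<in> T" using i 2(1) by auto
        then have "(i + 1) mod m = Suc (Suc j)" using lt[of j] by simp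
        then show ?thesis using T(3)[OF j(2)] lt[OF j(2)] by (auto simp: 2)
      qed
      ultimately show ?thesis by (simp add: cycle_independent_def)
    qed
  qed
  moreover have "?A \<inter> ?B = {}" using m by (auto simp: path_independent_sets_def)
  moreover have "inj_on ?f (path_independent_sets (m - 3) (k - 1))"
  proof (rule inj_onI)
    fix T U assume T: "T \<in> path_independent_sets (m - 3) (k - 1)"
      and U: "U \<in> path_independent_sets (m - 3) (k - 1)" and eq: "?f T = ?f U"
    have "m - 1 \<notin> Suc ` T" "m - 1 \<notin> Suc ` U"
      using T U by (force simp: path_independent_sets_def)+
    then have "Suc ` T = Suc ` U" using eq by (metis insert_ident)
    then show "T = U" by (simp add: inj_image_eq_iff)
  qed
  ultimately have "card {S. S \<subseteq> {..<m} \<and> card S = k \<and> cycle_independent m S}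
      = (m - 1 + 1 - k choose k) + (m - 3 + 1 - (k - 1) choose (k - 1))"
    by (simp add: card_Un_disjoint finite_path_independent_sets card_image card_path_independent_sets)
  moreover have "(m - 3 + 1 - (k - 1) choose (k - 1)) = (m - k - 1 choose (k - 1))"
  proof (cases "m = 2")
    case True
    then show ?thesis using k by (cases "k = 1") auto
  next
    case False
    then have "m - 3 + 1 - (k - 1) = m - k - 1" using m k by simp
    then show ?thesis by simp
  qed
  ultimately show ?thesis using m by simp
qed

section \<open>Rotation-invariant sets of residues\<close>

text \<open>
  The preimage of \<open>T\<close> under the reduction from residues modulo \<open>d * m\<close> to residues modulo \<open>m\<close>.
\<close>

definition unroll :: "nat \<Rightarrow> nat \<Rightarrow> nat set \<Rightarrow> nat set" where
  "unroll d m T = {i. i < d * m \<and> i mod m \<in> T}"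

lemma unroll_Int: "T \<subseteq> {..<m} \<Longrightarrow> d > 0 \<Longrightarrow> unroll d m T \<inter> {..<m} = T"
  by (cases d) (auto simp: unroll_def)

lemma card_unroll:
  assumes "T \<subseteq> {..<m}"
  shows "card (unroll d m T) = d * card T"
proof -
  have "bij_betw (\<lambda>(q, t). q * m + t) ({..<d} \<times> T) (unroll d m T)"
  proof (intro bij_betwI[where g = "\<lambda>i. (i div m, i mod m)"])
    show "(\<lambda>(q, t). q * m + t) \<in> {..<d} \<times> T \<rightarrow> unroll d m T"
    proof safe
      fix q t assume q: "q < d" and t: "t \<in> T"
      have "t < m" using t assms by auto
      then have "q * m + t < Suc q * m" by simp
      also have "\<dots> \<le> d * m" using q by (intro mult_le_mono1) simp
      finally show "q * m + t \<in> unroll d m T" using t \<open>t < m\<close> by (simp add: unroll_def)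
    qed
    show "(\<lambda>i. (i div m, i mod m)) \<in> unroll d m T \<rightarrow> {..<d} \<times> T"
      by (auto simp: unroll_def less_mult_imp_div_less)
  qed (use assms in \<open>auto simp: unroll_def\<close>)
  then show ?thesis by (simp add: card_cartesian_product flip: bij_betw_same_card)
qed

lemma rotation_invariant_unroll:
  assumes m: "m dvd s" and N: "d * m > 0"
  shows "(\<lambda>i. (i + s) mod (d * m)) ` unroll d m T = unroll d m T"
proof (rule endo_inj_surj)
  show "finite (unroll d m T)" by (simp add: unroll_def)
  have "(i + s) mod (d * m) mod m = i mod m" for i
    using m by (auto simp: mod_mod_cancel)
  then show "(\<lambda>i. (i + s) mod (d * m)) ` unroll d m T \<subseteq> unroll d m T"
    using N by (auto simp: unroll_def)
  show "inj_on (\<lambda>i. (i + s) mod (d * m)) (unroll d m T)"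
  proof (rule inj_onI)
    fix i j assume "i \<in> unroll d m T" "j \<in> unroll d m T"
      and "(i + s) mod (d * m) = (j + s) mod (d * m)"
    moreover from this(3) have "[i + s = j + s] (mod d * m)" by (simp add: cong_def)
    then have "[i = j] (mod d * m)" by (simp add: cong_add_rcancel_nat)
    ultimately show "i = j" by (auto simp: unroll_def cong_def)
  qed
qed

text \<open>
  Closure under a rotation implies closure under its multiples.  Combined with Bezout's identity
  it replaces the rotation by the one whose step is the greatest common divisor.
\<close>

lemma rotation_closed_multiple:
  assumes closed: "\<And>i. i \<in> S \<Longrightarrow> (i + s) mod N \<in> S" and S: "S \<subseteq> {..<N}" and i: "i \<in> (S :: nat set)"
  shows "(i + t * s) mod N \<in> S"
proof (induction t)
  case 0
  then show ?case using i S by auto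
next
  case (Suc t)
  have "(i + Suc t * s) mod N = ((i + t * s) mod N + s) mod N"
    by (simp add: mod_simps ac_simps)
  then show ?case using closed[OF Suc] by simp
qed

text \<open>
  The rotation by \<open>s\<close> generates the same group as the rotation by \<open>gcd s (d * m) = m\<close>, so that an
  invariant set is a union of residue classes modulo \<open>m\<close>.
\<close>

lemma rotation_invariant_eq_unroll:
  fixes s :: nat
  assumes gcd: "gcd s (d * m) = m" and N: "d * m > 0"
    and S: "S \<subseteq> {..<d * m}" and inv: "(\<lambda>i. (i + s) mod (d * m)) ` S = S"
  shows "S = unroll d m (S \<inter> {..<m})"
proof -
  define N where "N = d * m"
  have m: "m > 0" "d > 0" "m \<le> N" using N by (auto simp: N_def)
  have S': "S \<subseteq> {..<N}" using S by (simp add: N_def)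
  have step: "(i + m) mod N \<in> S" if "i \<in> S" for i
  proof (cases "s = 0")
    case True
    then have "N = m" using gcd unfolding N_def[symmetric] by simp
    then show ?thesis using that S' by auto
  next
    case False
    obtain x y where xy: "s * x = N * y + gcd s N" using bezout_nat[OF False] by metis
    have "(i + x * s) mod N \<in> S"
      by (rule rotation_closed_multiple) (use inv S that N_def in auto)
    also have "i + x * s = (i + m) + N * y" using xy gcd by (simp add: N_def mult.commute)
    finally show ?thesis by simp
  qed
  have closed: "(i + t * m) mod N \<in> S" if "i \<in> S" for i t
    using rotation_closed_multiple[of S m N i t] step S' that by blast
  have "i \<in> S \<longleftrightarrow> i mod m \<in> S" if i: "i < N" for i
  proof
    assume "i mod m \<in> S"
    from closed[OF this, of "i div m"] show "i \<in> S" using i by simp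
  next
    assume "i \<in> S"
    have le: "i div m \<le> d" using i by (simp add: N_def less_mult_imp_div_less order.strict_implies_order)
    \<comment> \<open>The remaining steps of length \<open>m\<close> wrap around to the residue of \<open>i\<close> modulo \<open>m\<close>.\<close>
    have "i + (d - i div m) * m = i mod m + (i div m) * m + (d - i div m) * m" by simp
    also have "\<dots> = i mod m + (i div m + (d - i div m)) * m"
      by (simp only: add_mult_distrib add.assoc)
    also have "\<dots> = i mod m + N" using le by (simp add: N_def)
    finally have "(i mod m + N) mod N \<in> S" using closed[OF \<open>i \<in> S\<close>, of "d - i div m"] by simp
    moreover have "i mod m < N" using m by (meson mod_less_divisor order_less_le_trans)
    ultimately show "i mod m \<in> S" by simp
  qed
  then show ?thesis using S' m by (auto simp: unroll_def N_def)
qed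

text \<open>
  Unrolling is a bijection from the subsets of \<open>{..<m}\<close> onto the sets invariant under rotation by \<open>s\<close>,
  and multiplies cardinalities by \<open>d\<close>.  The predicates \<open>P\<close> and \<open>Q\<close> let the same count serve the
  independent sets avoiding the hub and those containing it.
\<close>

lemma card_rotation_invariant:
  fixes s :: nat
  assumes gcd: "gcd s (d * m) = m" and N: "d * m > 0"
    and PQ: "\<And>T. T \<subseteq> {..<m} \<Longrightarrow> P (unroll d m T) \<longleftrightarrow> Q T"
  shows "card {S. S \<subseteq> {..<d * m} \<and> card S = k \<and> P S \<and> (\<lambda>i. (i + s) mod (d * m)) ` S = S}
    = (if d dvd k then card {T. T \<subseteq> {..<m} \<and> card T = k div d \<and> Q T} else 0)" (is "card ?F = _")
proof -
  let ?T = "{T. T \<subseteq> {..<m} \<and> d * card T = k \<and> Q T}"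
  have d: "d > 0" using N by simp
  have "?F = unroll d m ` ?T"
  proof (intro equalityI subsetI)
    fix S assume S: "S \<in> ?F"
    define T where "T = S \<inter> {..<m}"
    have ST: "S = unroll d m T"
      unfolding T_def using S by (intro rotation_invariant_eq_unroll[OF gcd N]) auto
    moreover have "T \<subseteq> {..<m}" by (simp add: T_def)
    ultimately have "T \<in> ?T" using S PQ[of T] card_unroll[of T m d] by auto
    then show "S \<in> unroll d m ` ?T" using ST by blast
  next
    fix S assume "S \<in> unroll d m ` ?T"
    then obtain T where T: "S = unroll d m T" "T \<subseteq> {..<m}" "d * card T = k" "Q T" by auto
    have "m dvd s" using gcd by (metis gcd_dvd1)
    then have "(\<lambda>i. (i + s) mod (d * m)) ` S = S"
      unfolding T(1) by (rule rotation_invariant_unroll[OF _ N])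
    moreover have "S \<subseteq> {..<d * m}" by (auto simp: T(1) unroll_def)
    ultimately show "S \<in> ?F" using T PQ[of T] by (simp add: card_unroll)
  qed
  moreover have "inj_on (unroll d m) ?T"
    by (intro inj_onI) (metis (mono_tags, lifting) d mem_Collect_eq unroll_Int)
  ultimately have "card ?F = card ?T" by (simp add: card_image)
  moreover have "?T = (if d dvd k then {T. T \<subseteq> {..<m} \<and> card T = k div d \<and> Q T} else {})"
    using d by auto
  ultimately show ?thesis by simp
qed

lemma cycle_independent_unroll:
  assumes "T \<subseteq> {..<m}" "d * m > 0"
  shows "cycle_independent (d * m) (unroll d m T) \<longleftrightarrow> cycle_independent m T"
proof -
  have *: "(i + 1) mod (d * m) mod m = (i mod m + 1) mod m" for i
    by (simp add: mod_mod_cancel mod_simps)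
  have "(\<forall>i\<in>unroll d m T. (i + 1) mod (d * m) \<notin> unroll d m T)
      \<longleftrightarrow> (\<forall>i\<in>unroll d m T. (i mod m + 1) mod m \<notin> T)"
    using assms(2) * by (simp add: unroll_def)
  also have "\<dots> \<longleftrightarrow> (\<forall>i\<in>T. (i + 1) mod m \<notin> T)"
  proof
    assume L: "\<forall>i\<in>unroll d m T. (i mod m + 1) mod m \<notin> T"
    show "\<forall>i\<in>T. (i + 1) mod m \<notin> T"
    proof
      fix i assume "i \<in> T"
      then have "i \<in> unroll d m T" "i < m" using unroll_Int[OF assms(1), of d] assms by auto
      then show "(i + 1) mod m \<notin> T" using L by force
    qed
  qed (auto simp: unroll_def)
  finally show ?thesis by (simp add: cycle_independent_def)
qed

lemma Ball_odd_unroll: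
  assumes "T \<subseteq> {..<m}" "d > 0" "even m"
  shows "(\<forall>i\<in>unroll d m T. odd i) \<longleftrightarrow> (\<forall>i\<in>T. odd i)"
proof -
  have "odd (i mod m) \<longleftrightarrow> odd i" for i using assms(3) by (simp add: dvd_mod_iff)
  moreover have "T \<subseteq> unroll d m T" using unroll_Int[OF assms(1,2)] by blast
  ultimately show ?thesis by (auto simp: unroll_def)
qed

lemma card_odd_subsets:
  "card {T. T \<subseteq> {..<2 * p} \<and> card T = k \<and> (\<forall>i\<in>T. odd i)} = (p choose k)"
proof -
  let ?O = "(\<lambda>j. Suc (2 * j)) ` {..<p}"
  have "?O = {i. i < 2 * p \<and> odd i}"
  proof (intro equalityI subsetI)
    fix i assume "i \<in> {i. i < 2 * p \<and> odd i}"
    then have "i < 2 * p" "i = Suc (2 * (i div 2))" by (auto simp: odd_Suc_div_two)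
    then show "i \<in> ?O" by (intro image_eqI[of _ _ "i div 2"]) auto
  qed auto
  then have "{T. T \<subseteq> {..<2 * p} \<and> card T = k \<and> (\<forall>i\<in>T. odd i)} = {T. T \<subseteq> ?O \<and> card T = k}" by auto
  moreover have "card ?O = p" by (subst card_image) (auto simp: inj_on_def)
  ultimately show ?thesis by (simp add: n_subsets)
qed

section \<open>The action on independent sets\<close>

lemma group_action_set_action:
  assumes act: "group_action G E \<phi>"
    and X: "X \<subseteq> Pow E" "\<And>h S. h \<in> carrier G \<Longrightarrow> S \<in> X \<Longrightarrow> \<phi> h ` S \<in> X"
  shows "group_action G X (set_action \<phi> X)"
proof -
  interpret group_action G E \<phi> by (rule act)
  interpret group G using group_hom group_hom.axioms(1) by auto
  have comp: "\<phi> (h1 \<otimes>\<^bsub>G\<^esub> h2) ` S = \<phi> h1 ` \<phi> h2 ` S"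
    if "h1 \<in> carrier G" "h2 \<in> carrier G" "S \<in> X" for h1 h2 S
    using that X(1) by (force simp: image_image composition_rule intro!: image_cong)
  have one: "\<phi> \<one>\<^bsub>G\<^esub> ` S = S" if "S \<in> X" for S
    using that X(1) by (force simp flip: id_eq_one)
  have bij: "set_action \<phi> X h \<in> Bij X" if h: "h \<in> carrier G" for h
  proof -
    have "bij_betw (set_action \<phi> X h) X X"
      by (rule bij_betwI[where g = "\<lambda>S. \<phi> (inv\<^bsub>G\<^esub> h) ` S"])
         (use h X(2) comp[symmetric] one in \<open>auto simp: set_action_def\<close>)
    then show ?thesis by (simp add: Bij_def set_action_def)
  qed
  show ?thesis
  proof (intro group_action.intro group_hom.intro group_hom_axioms.intro homI)
    fix h1 h2 assume h: "h1 \<in> carrier G" "h2 \<in> carrier G"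
    have "set_action \<phi> X (h1 \<otimes>\<^bsub>G\<^esub> h2) = compose X (set_action \<phi> X h1) (set_action \<phi> X h2)"
      using h X(2) by (auto simp: set_action_def compose_def comp fun_eq_iff)
    then show "set_action \<phi> X (h1 \<otimes>\<^bsub>G\<^esub> h2) = set_action \<phi> X h1 \<otimes>\<^bsub>BijGroup X\<^esub> set_action \<phi> X h2"
      using bij h by (simp add: BijGroup_def)
  next
    fix h assume "h \<in> carrier G"
    then show "set_action \<phi> X h \<in> carrier (BijGroup X)" using bij by (simp add: BijGroup_def)
  qed (simp_all add: group_BijGroup is_group)
qed

text \<open>
  Independence means absence of arcs in the image, and an arc between images is carried by the
  inverse group element to an arc between the original vertices.  Preservation of arcs in one
  direction therefore suffices.
\<close>

lemma group_action_independent_sets: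
  assumes act: "group_action C (pverts G) \<phi>"
    and arcs: "\<And>h u v. h \<in> carrier C \<Longrightarrow> (u, v) \<in> parcs G \<Longrightarrow> (\<phi> h u, \<phi> h v) \<in> parcs G"
  shows "group_action C (independent_sets G k) (set_action \<phi> (independent_sets G k))"
proof (rule group_action_set_action[OF act])
  interpret group_action C "pverts G" \<phi> by (rule act)
  interpret group C using group_hom group_hom.axioms(1) by auto
  show "independent_sets G k \<subseteq> Pow (pverts G)" by (auto simp: independent_sets_def)
  fix h S assume h: "h \<in> carrier C" and "S \<in> independent_sets G k"
  then have S: "S \<subseteq> pverts G" "finite S" "card S = k" "\<And>u v. u \<in> S \<Longrightarrow> v \<in> S \<Longrightarrow> (u, v) \<notin> parcs G"
    by (auto simp: independent_sets_def)
  have "\<phi> h ` S \<subseteq> pverts G" using surj_prop[OF h] S(1) by blast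
  moreover have "card (\<phi> h ` S) = k"
    using inj_on_subset[OF inj_prop[OF h] S(1)] S(3) by (simp add: card_image)
  moreover have "(\<phi> h u, \<phi> h v) \<notin> parcs G" if "u \<in> S" "v \<in> S" for u v
  proof
    assume "(\<phi> h u, \<phi> h v) \<in> parcs G"
    then have "(\<phi> (inv\<^bsub>C\<^esub> h) (\<phi> h u), \<phi> (inv\<^bsub>C\<^esub> h) (\<phi> h v)) \<in> parcs G"
      using arcs h by simp
    then show False using orbit_sym_aux[OF h] S that by (metis subsetD)
  qed
  ultimately show "\<phi> h ` S \<in> independent_sets G k" using S(2) by (auto simp: independent_sets_def)
qed

lemma pverts_gear_graph [simp]: "pverts (gear_graph n) = {0..2 * n}"
  by (simp add: gear_graph_def Let_def)

lemma gear_rotation_preserves_arcs: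
  assumes n: "n \<ge> 1" and uv: "(u, v) \<in> parcs (gear_graph n)"
    and rot: "\<And>i. i < 2 * n \<Longrightarrow> f i = (i + 2 * j) mod (2 * n)" and hub: "f (2 * n) = 2 * n"
  shows "(f u, f v) \<in> parcs (gear_graph n)"
proof -
  define E where "E = {(i, (i + 1) mod (2 * n)) | i. i < 2 * n} \<union> {(2 * n, 2 * i) | i. i < n}"
  have parcs: "parcs (gear_graph n) = E \<union> E\<inverse>" by (simp add: gear_graph_def E_def Let_def)
  have E: "(f a, f b) \<in> E" if "(a, b) \<in> E" for a b
  proof -
    consider (rim) "a < 2 * n" "b = (a + 1) mod (2 * n)" | (spoke) i where "a = 2 * n" "b = 2 * i" "i < n"
      using \<open>(a, b) \<in> E\<close> by (auto simp: E_def)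
    then show ?thesis
    proof cases
      case rim
      have "f b = (f a + 1) mod (2 * n)" using n by (simp add: rim rot mod_simps add_ac)
      moreover have "f a < 2 * n" using n rim by (simp add: rot)
      ultimately show ?thesis by (auto simp: E_def)
    next
      case spoke
      have "f b = 2 * ((i + j) mod n)" using spoke by (simp add: rot mult_mod_right)
      moreover have "(i + j) mod n < n" using n by simp
      ultimately show ?thesis using hub spoke by (auto simp: E_def)
    qed
  qed
  show ?thesis using uv E unfolding parcs by auto
qed

lemma independent_set_gear_without_hub:
  "{S \<in> independent_sets (gear_graph n) k. 2 * n \<notin> S}
     = {S. S \<subseteq> {..<2 * n} \<and> card S = k \<and> cycle_independent (2 * n) S}"
proof -
  have "S \<in> independent_sets (gear_graph n) k \<longleftrightarrow> S \<subseteq> {..<2 * n} \<and> card S = k \<and> cycle_independent (2 * n) S"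
    if hub: "2 * n \<notin> S" for S
  proof -
    have sub: "S \<subseteq> {0..2 * n} \<longleftrightarrow> S \<subseteq> {..<2 * n}" using hub by (auto simp: le_less)
    have "(\<forall>u\<in>S. \<forall>v\<in>S. (u, v) \<notin> parcs (gear_graph n)) \<longleftrightarrow> cycle_independent (2 * n) S"
      if "S \<subseteq> {..<2 * n}"
      using that hub by (fastforce simp: gear_graph_def Let_def cycle_independent_def)
    then show ?thesis
      by (auto simp: independent_sets_def sub intro: finite_subset)
  qed
  then show ?thesis by auto
qed

text \<open>
  The hub is adjacent to all even rim vertices, and odd rim vertices are pairwise non-adjacent since
  rim edges change parity.  Once the hub is chosen, any set of odd vertices may be added.
\<close>

lemma independent_set_gear_with_hub:
  assumes n: "n \<ge> 1" and k: "k \<ge> 1"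
  shows "{S \<in> independent_sets (gear_graph n) k. 2 * n \<in> S}
     = insert (2 * n) ` {S. S \<subseteq> {..<2 * n} \<and> card S = k - 1 \<and> (\<forall>i\<in>S. odd i)}"
proof (intro equalityI subsetI)
  fix S assume "S \<in> {S \<in> independent_sets (gear_graph n) k. 2 * n \<in> S}"
  then have S: "S \<subseteq> {0..2 * n}" "finite S" "card S = k" "2 * n \<in> S"
    and ind: "\<And>v. v \<in> S \<Longrightarrow> (2 * n, v) \<notin> parcs (gear_graph n)"
    by (auto simp: independent_sets_def)
  define T where "T = S - {2 * n}"
  have T: "T \<subseteq> {..<2 * n}" using S(1) by (auto simp: T_def le_less)
  moreover have "odd i" if "i \<in> T" for i
  proof
    assume "even i"
    then obtain l where "i = 2 * l" by auto
    then show False using that T ind[of i] by (auto simp: T_def gear_graph_def Let_def)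
  qed
  moreover have "card T = k - 1" "S = insert (2 * n) T" using S by (auto simp: T_def)
  ultimately show "S \<in> insert (2 * n) ` {S. S \<subseteq> {..<2 * n} \<and> card S = k - 1 \<and> (\<forall>i\<in>S. odd i)}" by blast
next
  fix S assume "S \<in> insert (2 * n) ` {S. S \<subseteq> {..<2 * n} \<and> card S = k - 1 \<and> (\<forall>i\<in>S. odd i)}"
  then obtain T where S: "S = insert (2 * n) T"
    and T: "T \<subseteq> {..<2 * n}" "card T = k - 1" "\<And>i. i \<in> T \<Longrightarrow> odd i" by auto
  have fin: "finite T" using T(1) finite_subset by blast
  have "2 * n \<notin> T" using T(1) by auto
  moreover have "(u, v) \<notin> parcs (gear_graph n)" if "u \<in> S" "v \<in> S" for u v
  proof -
    have lt: "i < 2 * n" if "i \<in> T" for i using that T(1) by auto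
    have "odd (i mod (2 * n)) \<longleftrightarrow> odd i" for i by (simp add: dvd_mod_iff)
    then have "(a, b) \<notin> {(i, (i + 1) mod (2 * n)) | i. i < 2 * n} \<union> {(2 * n, 2 * i) | i. i < n}"
      if ab: "a \<in> S" "b \<in> S" for a b
    proof -
      have 1: "odd x" if "x \<in> S" "x < 2 * n" for x using that S T(3) by auto
      have 2: "(a + 1) mod (2 * n) < 2 * n" using n by simp
      have 3: "odd ((a + 1) mod (2 * n)) \<longleftrightarrow> odd (a + 1)" by (simp add: dvd_mod_iff)
      show ?thesis using ab 1 2 3 by fastforce
    qed
    then show ?thesis using that by (auto simp: gear_graph_def Let_def)
  qed
  moreover have "T \<subseteq> {0..2 * n}" using T(1) by auto
  ultimately show "S \<in> {S \<in> independent_sets (gear_graph n) k. 2 * n \<in> S}"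
    using S T(2) fin k by (auto simp: independent_sets_def)
qed

text \<open>
  Sets avoiding the hub correspond to independent sets of the cycle of length \<open>2p\<close>, and sets
  containing it to subsets of the \<open>p\<close> odd residues modulo \<open>2p\<close>; in each case the
  number of rim vertices is divided by \<open>d\<close>.
\<close>

lemma card_fixed_independent_sets_gear:
  assumes n: "n \<ge> 1" and k: "k \<ge> 1" and gcd: "gcd j n = p" and d: "n = d * p"
    and rot: "\<And>i. i < 2 * n \<Longrightarrow> f i = (i + 2 * j) mod (2 * n)" and hub: "f (2 * n) = 2 * n"
  shows "card {S \<in> independent_sets (gear_graph n) k. f ` S = S}
    = (if d dvd k then (2 * p - k div d choose (k div d)) + (2 * p - k div d - 1 choose (k div d - 1)) else 0)
      + (if d dvd k - 1 then p choose ((k - 1) div d) else 0)"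
proof -
  let ?r = "\<lambda>i. (i + 2 * j) mod (2 * n)"
  have N: "2 * n = d * (2 * p)" "d * (2 * p) > 0" "p \<ge> 1" using d n by (auto simp: Suc_le_eq)
  have "gcd (2 * j) (d * (2 * p)) = 2 * p"
    using gcd_mult_distrib_nat[of 2 j n] gcd N(1) by simp
  note count = card_rotation_invariant[OF this N(2), unfolded N(1)[symmetric]]
  have fr: "f ` S = ?r ` S" if "S \<subseteq> {..<2 * n}" for S
    using that rot by (intro image_cong) auto
  let ?A = "{S. S \<subseteq> {..<2 * n} \<and> card S = k \<and> cycle_independent (2 * n) S \<and> ?r ` S = S}"
  let ?B = "{S. S \<subseteq> {..<2 * n} \<and> card S = k - 1 \<and> (\<forall>i\<in>S. odd i) \<and> ?r ` S = S}"
  have "{S \<in> independent_sets (gear_graph n) k. f ` S = S}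
      = {S \<in> {S \<in> independent_sets (gear_graph n) k. 2 * n \<notin> S}. f ` S = S}
        \<union> {S \<in> {S \<in> independent_sets (gear_graph n) k. 2 * n \<in> S}. f ` S = S}"
    by blast
  also have "{S \<in> {S \<in> independent_sets (gear_graph n) k. 2 * n \<notin> S}. f ` S = S} = ?A"
  proof -
    have "f ` S = S \<longleftrightarrow> ?r ` S = S" if "S \<subseteq> {..<2 * n}" for S by (simp only: fr[OF that])
    then show ?thesis unfolding independent_set_gear_without_hub by blast
  qed
  also have "{S \<in> {S \<in> independent_sets (gear_graph n) k. 2 * n \<in> S}. f ` S = S} = insert (2 * n) ` ?B"
  proof -
    have eq: "f ` insert (2 * n) T = insert (2 * n) T \<longleftrightarrow> ?r ` T = T" if T: "T \<subseteq> {..<2 * n}" for T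
    proof -
      have "f ` insert (2 * n) T = insert (2 * n) (?r ` T)" using fr[OF T] hub by simp
      moreover have "?r ` T \<subseteq> {..<2 * n}" using n by (intro image_subsetI) simp
      then have "2 * n \<notin> ?r ` T" by blast
      moreover have "2 * n \<notin> T" using T by auto
      ultimately show ?thesis by (metis insert_ident)
    qed
    have "{S \<in> insert (2 * n) ` Q. f ` S = S}
        = insert (2 * n) ` {T \<in> Q. f ` insert (2 * n) T = insert (2 * n) T}" for Q
      by blast
    also have "{T \<in> {S. S \<subseteq> {..<2 * n} \<and> card S = k - 1 \<and> (\<forall>i\<in>S. odd i)}.
        f ` insert (2 * n) T = insert (2 * n) T} = ?B"
    proof (rule Collect_cong)
      fix T
      show "(T \<in> {S. S \<subseteq> {..<2 * n} \<and> card S = k - 1 \<and> (\<forall>i\<in>S. odd i)}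
          \<and> f ` insert (2 * n) T = insert (2 * n) T)
        = (T \<subseteq> {..<2 * n} \<and> card T = k - 1 \<and> (\<forall>i\<in>T. odd i) \<and> ?r ` T = T)"
      proof (cases "T \<subseteq> {..<2 * n}")
        case True
        show ?thesis by (simp only: mem_Collect_eq eq[OF True] conj_assoc)
      qed (simp only: mem_Collect_eq simp_thms)
    qed
    finally show ?thesis unfolding independent_set_gear_with_hub[OF n k] .
  qed
  finally have split: "{S \<in> independent_sets (gear_graph n) k. f ` S = S} = ?A \<union> insert (2 * n) ` ?B" .
  have "card (?A \<union> insert (2 * n) ` ?B) = card ?A + card (insert (2 * n) ` ?B)"
  proof (rule card_Un_disjoint)
    show "finite ?A" "finite (insert (2 * n) ` ?B)"
      by (auto intro!: finite_imageI intro: finite_subset[of _ "Pow {..<2 * n}"])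
    show "?A \<inter> insert (2 * n) ` ?B = {}" by blast
  qed
  moreover have "card (insert (2 * n) ` ?B) = card ?B"
  proof (rule card_image, rule inj_onI)
    fix S T assume "S \<in> ?B" "T \<in> ?B" and eq: "insert (2 * n) S = insert (2 * n) T"
    then have "2 * n \<notin> S" "2 * n \<notin> T" by auto
    with eq show "S = T" by (metis insert_ident)
  qed
  moreover have "card ?A = (if d dvd k then (2 * p - k div d choose (k div d))
      + (2 * p - k div d - 1 choose (k div d - 1)) else 0)"
  proof -
    have "card ?A = (if d dvd k then
        card {T. T \<subseteq> {..<2 * p} \<and> card T = k div d \<and> cycle_independent (2 * p) T} else 0)"
      by (rule count) (unfold N(1), rule cycle_independent_unroll[OF _ N(2)], assumption)
    moreover have "k div d \<ge> 1" if "d dvd k" using that k by (auto elim!: dvdE)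
    moreover have "2 * p \<ge> 2" using N(3) by simp
    ultimately show ?thesis using card_cycle_independent[of "2 * p" "k div d"] by simp
  qed
  moreover have "card ?B = (if d dvd k - 1 then p choose ((k - 1) div d) else 0)"
  proof -
    have "card ?B = (if d dvd k - 1 then
        card {T. T \<subseteq> {..<2 * p} \<and> card T = (k - 1) div d \<and> (\<forall>i\<in>T. odd i)} else 0)"
      by (rule count) (use Ball_odd_unroll[of _ "2 * p" d] N(2) in simp)
    then show ?thesis by (simp add: card_odd_subsets)
  qed
  ultimately show ?thesis by (simp only: split)
qed

theorem proposition12:
  fixes n k :: nat
    and C :: "('g, 'r) monoid_scheme"
    and g :: 'g
    and \<phi> :: "'g \<Rightarrow> nat \<Rightarrow> nat"
  assumes "n \<ge> 1" and "k \<ge> 1"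
    and "group C" and "Coset.order C = n"
    and "g \<in> carrier C" and "generate C {g} = carrier C"
    and "group_action C (pverts (gear_graph n)) \<phi>"
    and "\<And>i. i < 2 * n \<Longrightarrow> \<phi> g i = (i + 2) mod (2 * n)"
    and "\<phi> g (2 * n) = 2 * n"
  shows "cyclic_sieving (independent_sets (gear_graph n) k) C
           (set_action \<phi> (independent_sets (gear_graph n) k))
           (qlucas_term n k + qbinomial n (k - 1))"
proof -
  let ?I = "independent_sets (gear_graph n) k"
  note n = assms(1) and k = assms(2) and g = assms(5)
  interpret group C by (rule assms(3))
  interpret group_action C "pverts (gear_graph n)" \<phi> by (rule assms(7))
  have fin: "finite (carrier C)"
    using assms(4) n by (intro card_ge_0_finite) (simp add: Coset.order_def)
  have cyc: "cyclic_group C"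
    unfolding cyclic_group using generate_pow[OF g] assms(6)
    by (intro bexI[OF _ g]) (simp add: full_SetCompr_eq)
  have ord_g: "ord g = n"
    using generate_pow_card[OF g] assms(4,6) by (simp add: Coset.order_def)
  have power: "\<exists>j. h = g [^]\<^bsub>C\<^esub> (j :: nat)" if "h \<in> carrier C" for h
    using generate_pow_on_finite_carrier[OF fin g] assms(6) that by auto
  have rot: "(\<forall>i<2 * n. \<phi> (g [^]\<^bsub>C\<^esub> j) i = (i + 2 * j) mod (2 * n)) \<and> \<phi> (g [^]\<^bsub>C\<^esub> j) (2 * n) = 2 * n"
    for j :: nat
  proof (induction j)
    case 0
    have "\<phi> \<one>\<^bsub>C\<^esub> i = i" if "i \<le> 2 * n" for i
      using that by (simp flip: id_eq_one)
    then show ?case by simp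
  next
    case (Suc j)
    have "\<phi> (g [^]\<^bsub>C\<^esub> Suc j) i = \<phi> (g [^]\<^bsub>C\<^esub> j) (\<phi> g i)" if "i \<le> 2 * n" for i
      using that g by (simp add: composition_rule)
    then show ?case using Suc assms(8,9) n by (simp add: mod_simps add_ac)
  qed
  have act: "group_action C ?I (set_action \<phi> ?I)"
  proof (rule group_action_independent_sets[OF assms(7)])
    fix h u v assume h: "h \<in> carrier C" and uv: "(u, v) \<in> parcs (gear_graph n)"
    obtain j :: nat where j: "h = g [^]\<^bsub>C\<^esub> j" using power[OF h] by blast
    show "(\<phi> h u, \<phi> h v) \<in> parcs (gear_graph n)"
      by (rule gear_rotation_preserves_arcs[OF n uv, where j = j]) (simp_all add: j rot)
  qed
  have "finite ?I"
    by (rule finite_subset[of _ "Pow {0..2 * n}"]) (auto simp: independent_sets_def)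
  moreover have "of_nat (card (invariants ?I (set_action \<phi> ?I) h))
      = poly (qlucas_term n k + qbinomial n (k - 1)) \<omega>"
    if h: "h \<in> carrier C" and \<omega>: "primitive_root_of_unity (ord h) \<omega>" for h \<omega>
  proof -
    obtain j :: nat where j: "h = g [^]\<^bsub>C\<^esub> j" using power[OF h] by blast
    define p where "p = gcd j n"
    define d where "d = ord h"
    have "d = n div p"
      using ord_pow_gen[OF g, of j] n by (simp add: d_def j p_def ord_g gcd.commute)
    then have np: "n = d * p" by (simp add: p_def)
    then have "2 * n = d * (2 * p)" "2 * p \<ge> 2" using n by (auto simp: Suc_le_eq)
    note lucas = poly_qlucas_term[OF \<omega>[folded d_def] this k]
    have "invariants ?I (set_action \<phi> ?I) h = {S \<in> ?I. \<phi> h ` S = S}"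
      by (auto simp: invariants_def set_action_def)
    then show ?thesis
      using card_fixed_independent_sets_gear[OF n k p_def[symmetric] np, of "\<phi> h"] rot[of j]
        lucas poly_qbinomial_order_dvd[OF \<omega>[folded d_def], of p "k - 1", folded np]
      by (simp add: j)
  qed
  ultimately show ?thesis
    unfolding cyclic_sieving_def using is_group cyc fin act by blast
qed

end
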